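(* Let $\mathfrak p_1,\mathfrak p_2\in L_{n,m}$ have height sequences $(h^{(1)}_1,\dots,h^{(1)}_n)$ and $(h^{(2)}_1,\dots,h^{(2)}_n)$. Then the relative pseudocomplement $\mathfrak p_1\to\mathfrak p_2$ in $\mathcal{L}_{n,m}$ is the path $\mathfrak p\in L_{n,m}$ with height sequence $(h_1,\dots,h_n)$ defined (recursively from the right) by $$h_i=\begin{cases} m,& i=n \text{ and } h^{(1)}_i\le h^{(2)}_i,\\ h_{i+1},& i<n \text{ and } h^{(1)}_i\le h^{(2)}_i,\\ h^{(2)}_i,& i\le n\text{ and } h^{(1)}_i>h^{(2)}_i.\end{cases}$$
   Context: $L_{n,m}$ is the set of lattice paths from $(0,0)$ to $(n,m)$ using up-steps $(0,1)$ and right-steps $(1,0)$. Such a path is uniquely determined by its height sequence $(h_1,\dots,h_n)$, where $h_i$ is the number of up-steps before the $i$-th right-step; these are exactly the integer sequences $0\le h_1\le h_2\le\dots\le h_n\le m$. $\mathcal{L}_{n,m}$ is $L_{n,m}$ with the dominance order: $\mathfrak p\le_D\mathfrak p'$ iff the height sequences satisfy $h_i\le h'_i$ for all $i$; it is a lattice with meet and join given by componentwise min and max. The relative pseudocomplement $x\to y$ is the greatest $z$ with $x\wedge z\le y$. *)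

theory Defs
  imports "HOL-Algebra.Lattice"
begin

datatype step = Up_Step | Right_Step

text \<open>A path starting at \<open>(0,0)\<close> is encoded by its list of steps, so its end point is
  (number of right-steps, number of up-steps).\<close>

definition lattice_paths :: "nat \<Rightarrow> nat \<Rightarrow> step list set" where
  "lattice_paths n m = {p. count_list p Right_Step = n \<and> count_list p Up_Step = m}"

definition height_seq :: "step list \<Rightarrow> nat list" where
  "height_seq p = [count_list (take j p) Up_Step. j \<leftarrow> [0..<length p], p ! j = Right_Step]"

text \<open>Heights are indexed from 1; \<open>height p i\<close> is meaningful for \<open>1 \<le> i \<le> n\<close> when
  \<open>p \<in> lattice_paths n m\<close>.\<close>

definition height :: "step list \<Rightarrow> nat \<Rightarrow> nat" where
  "height p i = height_seq p ! (i - 1)"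

definition dominance_order :: "nat \<Rightarrow> nat \<Rightarrow> step list gorder" where
  "dominance_order n m =
     \<lparr>carrier = lattice_paths n m, eq = (=),
      le = (\<lambda>p q. \<forall>i\<in>{1..n}. height p i \<le> height q i)\<rparr>"

definition is_relative_pseudocomplement ::
    "('a, 'b) gorder_scheme \<Rightarrow> 'a \<Rightarrow> 'a \<Rightarrow> 'a \<Rightarrow> bool" where
  "is_relative_pseudocomplement L x y z \<longleftrightarrow>
     greatest L z {w \<in> carrier L. x \<sqinter>\<^bsub>L\<^esub> w \<sqsubseteq>\<^bsub>L\<^esub> y}"

end

theory Submission
  imports Defs
begin

text \<open>Paths in \<open>L\<^sub>n\<^sub>,\<^sub>m\<close> correspond bijectively to weakly increasing height functions bounded
  by \<open>m\<close>. For such a function \<open>w\<close>, the condition \<open>min h\<^sub>1 w \<le> h\<^sub>2\<close> only says that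
  \<open>w j \<le> h\<^sub>2 j\<close> at every index \<open>j\<close> with \<open>h\<^sub>2 j < h\<^sub>1 j\<close>; by monotonicity of \<open>w\<close> this is the same as
  \<open>w i \<le> min {m, h\<^sub>2 j | j \<ge> i, h\<^sub>2 j < h\<^sub>1 j}\<close> for all \<open>i\<close>. The right-hand side is itself a height
  function, and since \<open>h\<^sub>2\<close> is increasing it satisfies the stated recursion, which determines it
  uniquely by descending induction.\<close>

section \<open>Height sequences as an encoding of paths\<close>

lemma height_seq_Nil [simp]: "height_seq [] = []"
  by (simp add: height_seq_def)

text \<open>Trades the index-based definition for a recursion on the first step, which drives the
  inductions below.\<close>

lemma height_seq_Cons:
  "height_seq (s # p) =
     (case s of Up_Step \<Rightarrow> map Suc (height_seq p) | Right_Step \<Rightarrow> 0 # height_seq p)"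
proof -
  have split: "[0..<length (s # p)] = 0 # map Suc [0..<length p]"
    by (simp add: upt_conv_Cons map_Suc_upt del: upt_Suc)
  show ?thesis
    unfolding height_seq_def split
    by (cases s) (simp_all add: map_concat o_def if_distrib cong: if_cong)
qed

lemma height_seq_Up [simp]: "height_seq (Up_Step # p) = map Suc (height_seq p)"
  and height_seq_Right [simp]: "height_seq (Right_Step # p) = 0 # height_seq p"
  by (simp_all add: height_seq_Cons)

lemma length_height_seq [simp]: "length (height_seq p) = count_list p Right_Step"
proof (induction p)
  case (Cons s p)
  then show ?case by (cases s) auto
qed simp

lemma sorted_height_seq: "sorted (height_seq p)"
proof (induction p)
  case (Cons s p)
  then show ?case by (cases s) (auto simp: sorted_map)
qed simp

lemma height_seq_le: "h \<in> set (height_seq p) \<Longrightarrow> h \<le> count_list p Up_Step"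
proof (induction p arbitrary: h)
  case (Cons s p)
  then show ?case by (cases s) auto
qed simp

text \<open>A leading 0 reveals a right-step, and \<open>map Suc\<close> never produces one, so the
  first steps agree. Up-steps after the last right-step leave no trace in the heights; the second
  assumption accounts for them.\<close>

lemma height_seq_inject:
  assumes "height_seq p = height_seq q" "count_list p Up_Step = count_list q Up_Step"
  shows "p = q"
  using assms
proof (induction p arbitrary: q)
  case Nil
  then have "count_list q Right_Step = 0" "count_list q Up_Step = 0"
    by (metis height_seq_Nil length_height_seq count_list.simps(1))
       (use Nil in simp)
  then show ?case
    by (metis count_list_0_iff list.set_intros(1) neq_Nil_conv step.exhaust)
next
  case (Cons s p)
  show ?case
  proof (cases q)
    case Nil
    with Cons.prems show ?thesis by (cases s) auto
  next
    case (Cons t q')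
    with Cons.prems Cons.IH[of q'] show ?thesis
      by (cases s; cases t) (auto simp: Cons_eq_map_conv map_eq_Cons_conv)
  qed
qed

text \<open>Induction on the number of steps still to be placed. By sortedness a 0 in
  \<open>hs\<close> is its head and calls for a right-step; otherwise an up-step comes first and all
  heights drop by one.\<close>

lemma height_seq_surj:
  assumes "sorted hs" "\<forall>h\<in>set hs. h \<le> m"
  shows "\<exists>p\<in>lattice_paths (length hs) m. height_seq p = hs"
  using assms
proof (induction "m + length hs" arbitrary: m hs)
  case 0
  then show ?case by (intro bexI[of _ "[]"]) (auto simp: lattice_paths_def)
next
  case (Suc k)
  show ?case
  proof (cases "0 \<in> set hs")
    case True
    then obtain hs' where hs: "hs = 0 # hs'"
      using Suc.prems(1) by (cases hs) auto
    then obtain p where "p \<in> lattice_paths (length hs') m" "height_seq p = hs'"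
      using Suc.hyps(1)[of m hs'] Suc.hyps(2) Suc.prems by auto
    then show ?thesis
      by (intro bexI[of _ "Right_Step # p"]) (auto simp: hs lattice_paths_def)
  next
    case False
    \<comment> \<open>If \<open>hs\<close> is empty then \<open>m = Suc k\<close>; otherwise its
      head is positive and at most \<open>m\<close>.\<close>
    then have "m \<noteq> 0"
      using Suc.hyps(2) Suc.prems(2) by (cases hs) auto
    then obtain m' where m: "m = Suc m'"
      by (cases m) auto
    define hs' where "hs' = map (\<lambda>h. h - 1) hs"
    have hs: "hs = map Suc hs'"
      using False by (auto simp: hs'_def o_def intro!: map_idI[symmetric])
        (metis Suc_pred gr0I)
    then obtain p where "p \<in> lattice_paths (length hs') m'" "height_seq p = hs'"
      using Suc.hyps(1)[of m' hs'] Suc.hyps(2) Suc.prems m by (auto simp: sorted_map)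
    then show ?thesis
      by (intro bexI[of _ "Up_Step # p"]) (auto simp: hs m lattice_paths_def)
  qed
qed

lemma height_mono:
  assumes "p \<in> lattice_paths n m" "1 \<le> i" "i \<le> j" "j \<le> n"
  shows "height p i \<le> height p j"
  using assms sorted_nth_mono[OF sorted_height_seq, of "i - 1" "j - 1" p]
  by (simp add: height_def lattice_paths_def)

lemma height_le:
  assumes "p \<in> lattice_paths n m" "i \<in> {1..n}"
  shows "height p i \<le> m"
  using assms height_seq_le[of "height p i" p]
  by (auto simp: height_def lattice_paths_def)

lemma lattice_path_eqI:
  assumes "p \<in> lattice_paths n m" "q \<in> lattice_paths n m"
    and "\<And>i. i \<in> {1..n} \<Longrightarrow> height p i = height q i"
  shows "p = q"
proof (rule height_seq_inject)
  show "height_seq p = height_seq q"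
  proof (rule nth_equalityI)
    fix i assume "i < length (height_seq p)"
    then show "height_seq p ! i = height_seq q ! i"
      using assms(1,2) assms(3)[of "Suc i"] by (simp add: height_def lattice_paths_def)
  qed (use assms(1,2) in \<open>simp add: lattice_paths_def\<close>)
qed (use assms(1,2) in \<open>simp add: lattice_paths_def\<close>)

lemma ex_lattice_path_with_heights:
  assumes "\<And>i j. 1 \<le> i \<Longrightarrow> i \<le> j \<Longrightarrow> j \<le> n \<Longrightarrow> f i \<le> f j"
    and "\<And>i. i \<in> {1..n} \<Longrightarrow> f i \<le> m"
  obtains p where "p \<in> lattice_paths n m" "\<And>i. i \<in> {1..n} \<Longrightarrow> height p i = f i"
proof -
  let ?hs = "map (\<lambda>i. f (Suc i)) [0..<n]"
  have "sorted ?hs"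
    by (auto simp: sorted_iff_nth_mono intro!: assms(1))
  moreover have "\<forall>h\<in>set ?hs. h \<le> m"
    using assms(2) by auto
  ultimately obtain p where "p \<in> lattice_paths (length ?hs) m" "height_seq p = ?hs"
    using height_seq_surj by blast
  then show ?thesis
    by (intro that[of p]) (auto simp: height_def)
qed

section \<open>Order and meets in terms of heights\<close>

lemma dominance_order_simps [simp]:
  "carrier (dominance_order n m) = lattice_paths n m"
  "p \<sqsubseteq>\<^bsub>dominance_order n m\<^esub> q \<longleftrightarrow> (\<forall>i\<in>{1..n}. height p i \<le> height q i)"
  by (simp_all add: dominance_order_def)

text \<open>The library meet is a greatest lower bound picked by \<open>SOME\<close>, so one has to
  be exhibited first: the path \<open>r\<close> of componentwise minima. Two greatest lower bounds
  dominate each other and hence have equal heights.\<close>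

lemma height_meet:
  assumes p: "p \<in> lattice_paths n m" and q: "q \<in> lattice_paths n m" and i: "i \<in> {1..n}"
  shows "height (p \<sqinter>\<^bsub>dominance_order n m\<^esub> q) i = min (height p i) (height q i)"
proof -
  let ?L = "dominance_order n m"
  obtain r where r: "r \<in> lattice_paths n m"
    "\<And>i. i \<in> {1..n} \<Longrightarrow> height r i = min (height p i) (height q i)"
  proof (rule ex_lattice_path_with_heights)
    show "min (height p i) (height q i) \<le> min (height p j) (height q j)"
      if "1 \<le> i" "i \<le> j" "j \<le> n" for i j
      using height_mono[OF p that] height_mono[OF q that] by linarith
    show "min (height p i) (height q i) \<le> m" if "i \<in> {1..n}" for i
      using height_le[OF p that] by linarith
  qed blast
  have Lower: "Lower ?L {p, q} = {w \<in> lattice_paths n m.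
      \<forall>i\<in>{1..n}. height w i \<le> min (height p i) (height q i)}"
    using p q by (auto simp: Lower_def)
  have r_greatest: "greatest ?L r (Lower ?L {p, q})"
    using r by (auto simp: greatest_def Lower)
  then have "greatest ?L (p \<sqinter>\<^bsub>?L\<^esub> q) (Lower ?L {p, q})"
    unfolding meet_def inf_def by (rule someI)
  with r_greatest have "r \<sqsubseteq>\<^bsub>?L\<^esub> p \<sqinter>\<^bsub>?L\<^esub> q" "p \<sqinter>\<^bsub>?L\<^esub> q \<sqsubseteq>\<^bsub>?L\<^esub> r"
    by (metis greatest_def)+
  then have "height (p \<sqinter>\<^bsub>?L\<^esub> q) i = height r i"
    using i by (simp add: antisym)
  with r i show ?thesis by simp
qed

section \<open>The recursion and its closed form\<close>

lemma height_recursion_unique: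
  fixes f g :: "nat \<Rightarrow> nat"
  assumes f: "\<And>i. i \<in> {1..n} \<Longrightarrow> f i = (if P i then a i else if i = n then m else f (i + 1))"
    and g: "\<And>i. i \<in> {1..n} \<Longrightarrow> g i = (if P i then a i else if i = n then m else g (i + 1))"
    and "i \<in> {1..n}"
  shows "f i = g i"
  using assms(3)
\<comment> \<open>Descending induction: the base case is \<open>i = n\<close>, where the equations
  do not refer to index \<open>n + 1\<close>.\<close>
proof (induction "n - i" arbitrary: i)
  case 0
  then show ?case by (simp add: f g)
next
  case (Suc k)
  then have "f (i + 1) = g (i + 1)" by simp
  then show ?case using f[OF Suc.prems] g[OF Suc.prems] by simp
qed

definition pseudocomplement_height ::
    "nat \<Rightarrow> nat \<Rightarrow> (nat \<Rightarrow> nat) \<Rightarrow> (nat \<Rightarrow> nat) \<Rightarrow> nat \<Rightarrow> nat" where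
  "pseudocomplement_height n m h1 h2 i = Min (insert m (h2 ` {j \<in> {i..n}. h2 j < h1 j}))"

lemma le_pseudocomplement_height_iff:
  "k \<le> pseudocomplement_height n m h1 h2 i \<longleftrightarrow>
     k \<le> m \<and> (\<forall>j\<in>{i..n}. h2 j < h1 j \<longrightarrow> k \<le> h2 j)"
  by (auto simp: pseudocomplement_height_def)

text \<open>A larger index leaves fewer values to minimise over.\<close>

lemma pseudocomplement_height_mono:
  "i \<le> j \<Longrightarrow> pseudocomplement_height n m h1 h2 i \<le> pseudocomplement_height n m h1 h2 j"
  unfolding pseudocomplement_height_def by (rule Min_antimono) auto

text \<open>If \<open>i\<close> is itself a constrained index, \<open>h2 i\<close> is the minimum,
  since \<open>h2\<close> is smallest at \<open>i\<close> on the range; otherwise removing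
  \<open>i\<close> from the range changes nothing.\<close>

lemma pseudocomplement_height_rec:
  assumes mono: "\<And>j. i \<le> j \<Longrightarrow> j \<le> n \<Longrightarrow> h2 i \<le> h2 j"
    and "h2 i \<le> m" "i \<le> n"
  shows "pseudocomplement_height n m h1 h2 i =
    (if h2 i < h1 i then h2 i else if i = n then m else pseudocomplement_height n m h1 h2 (i + 1))"
proof (cases "h2 i < h1 i")
  case True
  then have "pseudocomplement_height n m h1 h2 i = h2 i"
    unfolding pseudocomplement_height_def by (intro Min_eqI) (use assms in auto)
  with True show ?thesis by simp
next
  case False
  then have "{j \<in> {i..n}. h2 j < h1 j} = {j \<in> {i + 1..n}. h2 j < h1 j}"
    by (auto simp: Suc_le_eq le_less)
  then have "pseudocomplement_height n m h1 h2 i = pseudocomplement_height n m h1 h2 (i + 1)"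
    unfolding pseudocomplement_height_def by (rule arg_cong)
  \<comment> \<open>Past the end no constraint remains and only the inserted \<open>m\<close>
    survives, so the case \<open>i = n\<close> is covered by the previous equation too.\<close>
  moreover have "pseudocomplement_height n m h1 h2 (n + 1) = m"
    by (simp add: pseudocomplement_height_def)
  ultimately show ?thesis
    using False by presburger
qed

theorem theorem3p1:
  fixes n m :: nat and p1 p2 :: "step list"
  assumes "p1 \<in> lattice_paths n m" and "p2 \<in> lattice_paths n m"
  shows "\<exists>p. (\<forall>q. (q \<in> lattice_paths n m \<and>
                 (\<forall>i\<in>{1..n}. height q i =
                    (if height p1 i > height p2 i then height p2 i
                     else if i = n then m
                     else height q (i + 1)))) \<longleftrightarrow> q = p) \<and>
             is_relative_pseudocomplement (dominance_order n m) p1 p2 p"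
proof -
  let ?L = "dominance_order n m"
  let ?h = "pseudocomplement_height n m (height p1) (height p2)"
  let ?rec = "\<lambda>q. \<forall>i\<in>{1..n}. height q i =
    (if height p1 i > height p2 i then height p2 i else if i = n then m else height q (i + 1))"
  obtain p where p: "p \<in> lattice_paths n m" and hp: "\<And>i. i \<in> {1..n} \<Longrightarrow> height p i = ?h i"
  proof (rule ex_lattice_path_with_heights[of n ?h m])
    show "?h i \<le> m" for i
      using le_pseudocomplement_height_iff by blast
  qed (simp_all add: pseudocomplement_height_mono)
  have rec: "?rec p"
  proof
    fix i assume i: "i \<in> {1..n}"
    then have "?h i = (if height p1 i > height p2 i then height p2 i
        else if i = n then m else ?h (i + 1))"
      using height_mono[OF assms(2)] height_le[OF assms(2)]
      by (intro pseudocomplement_height_rec) auto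
    with i show "height p i = (if height p1 i > height p2 i then height p2 i
        else if i = n then m else height p (i + 1))"
      by (simp add: hp)
  qed
  have unique: "q = p" if "q \<in> lattice_paths n m" "?rec q" for q
  proof (rule lattice_path_eqI[OF that(1) p])
    show "height q i = height p i" if "i \<in> {1..n}" for i
      by (rule height_recursion_unique[where P = "\<lambda>i. height p1 i > height p2 i" and a = "height p2"])
         (use \<open>?rec q\<close> rec that in blast)+
  qed
  \<comment> \<open>The set defining the pseudocomplement is thus the down-set of \<open>p\<close>,
    whose greatest element is \<open>p\<close> by reflexivity.\<close>
  have char: "p1 \<sqinter>\<^bsub>?L\<^esub> w \<sqsubseteq>\<^bsub>?L\<^esub> p2 \<longleftrightarrow> w \<sqsubseteq>\<^bsub>?L\<^esub> p" if w: "w \<in> lattice_paths n m" for w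
  proof -
    have "p1 \<sqinter>\<^bsub>?L\<^esub> w \<sqsubseteq>\<^bsub>?L\<^esub> p2 \<longleftrightarrow>
        (\<forall>j\<in>{1..n}. height p2 j < height p1 j \<longrightarrow> height w j \<le> height p2 j)"
      by (auto simp: height_meet[OF assms(1) w] min_le_iff_disj not_le)
    also have "\<dots> \<longleftrightarrow> (\<forall>i\<in>{1..n}. height w i \<le> ?h i)"
    proof (intro iffI ballI impI)
      fix i assume *: "\<forall>j\<in>{1..n}. height p2 j < height p1 j \<longrightarrow> height w j \<le> height p2 j"
        and i: "i \<in> {1..n}"
      have "height w i \<le> height p2 j" if "j \<in> {i..n}" "height p2 j < height p1 j" for j
      proof -
        have "height w i \<le> height w j"
          using i that by (intro height_mono[OF w]) auto
        also have "\<dots> \<le> height p2 j"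
          using * i that by simp
        finally show ?thesis .
      qed
      with height_le[OF w i] show "height w i \<le> ?h i"
        by (simp add: le_pseudocomplement_height_iff)
    \<comment> \<open>For the converse, the bound at index \<open>j\<close> already includes the
      constraint at \<open>j\<close> itself.\<close>
    qed (auto simp: le_pseudocomplement_height_iff)
    also have "\<dots> \<longleftrightarrow> w \<sqsubseteq>\<^bsub>?L\<^esub> p"
      by (simp add: hp)
    finally show ?thesis .
  qed
  have "is_relative_pseudocomplement ?L p1 p2 p"
    unfolding is_relative_pseudocomplement_def greatest_def
    using p char by auto
  with p rec unique show ?thesis by blast
qed

end
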